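(* Let $A \in \mathbb{R}^{m \times n}$ have columns $a^1,\dots,a^n \in \mathbb{R}^m$, and let $K \subset \mathbb{R}^m$ be a closed, convex, and pointed cone. For all $\beta \in \mathbb{R}^m$, the following three statements are equivalent: (i) the set $\mathbf{D}_+(\beta)$ is nonempty; (ii) $F_+ \in \mathbf{D}_+(\beta)$; (iii) $F_+(\beta) = -1$.
   Context: For $\beta^1,\beta^2\in\mathbb{R}^m$, $\beta^1 \preceq_K \beta^2$ means $\beta^2-\beta^1 \in K$. $\mathbb{Z}_+$ denotes the nonnegative integers. A function $F:\mathbb{R}^m\to\mathbb{R}$ is superadditive if $F(\beta^1)+F(\beta^2)\le F(\beta^1+\beta^2)$ for all $\beta^1,\beta^2\in\mathbb{R}^m$, and nondecreasing with respect to $K$ if $\beta^1\preceq_K\beta^2$ implies $F(\beta^1)\le F(\beta^2)$. $\Gamma^m$ is the set of all functions $F:\mathbb{R}^m\to\mathbb{R}$ that are superadditive and nondecreasing with respect to $K$. For $\beta\in\mathbb{R}^m$, $\mathbf{P}_+(\beta) = \{x : Ax \preceq_K \beta,\ x \in \mathbb{Z}^n_+\}$ and $\mathbf{D}_+(\beta) = \{F \in \Gamma^m : F(\beta)<0,\ F(a^j)\ge 0 \text{ for all } j=1,\dots,n\}$. The feasibility function $F_+:\mathbb{R}^m\to\mathbb{R}$ is defined by $F_+(\beta)=0$ if $\mathbf{P}_+(\beta)\ne\emptyset$ and $F_+(\beta)=-1$ if $\mathbf{P}_+(\beta)=\emptyset$.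
   Formalization: Functions in Γ^m are additionally required to satisfy F(0)=0; without this the equivalence fails, e.g. for m=n=1, A=(1), K=[0,∞), β=0 and F(x)=x−1, where (i) holds but (ii) and (iii) do not. *)

theory Defs
  imports "HOL-Analysis.Analysis"
begin

definition pointed :: "'a::real_vector set \<Rightarrow> bool" where
  "pointed K \<longleftrightarrow> K \<inter> uminus ` K = {0}"

definition cone_le :: "'a::real_vector set \<Rightarrow> 'a \<Rightarrow> 'a \<Rightarrow> bool" where
  "cone_le K b1 b2 \<longleftrightarrow> b2 - b1 \<in> K"

definition superadditive :: "('a::real_vector \<Rightarrow> real) \<Rightarrow> bool" where
  "superadditive F \<longleftrightarrow> (\<forall>b1 b2. F b1 + F b2 \<le> F (b1 + b2))"

definition nondecreasing_wrt :: "'a::real_vector set \<Rightarrow> ('a \<Rightarrow> real) \<Rightarrow> bool" where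
  "nondecreasing_wrt K F \<longleftrightarrow> (\<forall>b1 b2. cone_le K b1 b2 \<longrightarrow> F b1 \<le> F b2)"

(* Superadditivity alone only gives F 0 \<le> 0.  The normalisation F 0 = 0, customary for the
   functions of superadditive duality, is an explicit addition to "superadditive and
   nondecreasing".  Without it the equivalence fails: for m = n = 1, A = (1), K = [0, \<infinity>) the
   function F x = x - 1 would belong to dual_set A K 0 although x = 0 is in primal_set A K 0. *)
definition Gamma :: "(real^'m) set \<Rightarrow> (real^'m \<Rightarrow> real) set" where
  "Gamma K = {F. superadditive F \<and> nondecreasing_wrt K F \<and> F 0 = 0}"

definition primal_set :: "real^'n^'m \<Rightarrow> (real^'m) set \<Rightarrow> real^'m \<Rightarrow> (real^'n) set" where
  "primal_set A K b = {x. cone_le K (A *v x) b \<and> (\<forall>j. x $ j \<in> \<nat>)}"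

definition dual_set :: "real^'n^'m \<Rightarrow> (real^'m) set \<Rightarrow> real^'m \<Rightarrow> (real^'m \<Rightarrow> real) set" where
  "dual_set A K b = {F \<in> Gamma K. F b < 0 \<and> (\<forall>j. F (column j A) \<ge> 0)}"

definition feas_fun :: "real^'n^'m \<Rightarrow> (real^'m) set \<Rightarrow> real^'m \<Rightarrow> real" where
  "feas_fun A K b = (if primal_set A K b \<noteq> {} then 0 else - 1)"

end

theory Submission
  imports Defs
begin

text \<open>
  The set of right-hand sides with a feasible primal is an additive monoid containing the columns
  of \<open>A\<close> and upward closed for \<open>K\<close>; so its shifted indicator, the feasibility function, lies in
  \<open>\<Gamma>\<^sup>m\<close>. Conversely, for every \<open>F \<in> \<Gamma>\<^sup>m\<close> with \<open>F a\<^sup>j \<ge> 0\<close> the set where \<open>F \<ge> 0\<close> is such a monoid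
  too, hence contains every right-hand side with a feasible primal.
\<close>

lemma primal_set_zero:
  assumes "pointed K"
  shows "0 \<in> primal_set A K 0"
  using assms by (auto simp: primal_set_def cone_le_def pointed_def)

text \<open>The j-th unit vector is integral and meets the constraint with zero slack.\<close>

lemma primal_set_column:
  assumes "pointed K"
  shows "axis j 1 \<in> primal_set A K (column j A)"
proof -
  have "axis j 1 $ i \<in> (\<nat> :: real set)" for i
    by (simp add: axis_def)
  \<comment> \<open>\<open>cone\<close> also admits the empty set; \<open>pointed\<close> is what
    puts 0 into \<open>K\<close>.\<close>
  moreover have "0 \<in> K"
    using assms by (auto simp: pointed_def)
  ultimately show ?thesis
    by (simp add: primal_set_def cone_le_def matrix_vector_mult_basis)
qed

lemma convex_imp_cone_add_closed:
  assumes "convex K" "cone K" "x \<in> K" "y \<in> K"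
  shows "x + y \<in> K"
  using assms convex_cone by blast

lemma primal_set_add:
  assumes "convex K" "cone K" "x \<in> primal_set A K b" "y \<in> primal_set A K c"
  shows "x + y \<in> primal_set A K (b + c)"
proof -
  have "(b - A *v x) + (c - A *v y) \<in> K"
    using assms by (simp add: convex_imp_cone_add_closed primal_set_def cone_le_def)
  then show ?thesis
    using assms(3,4)
    by (simp add: primal_set_def cone_le_def matrix_vector_right_distrib add_diff_add)
qed

lemma primal_set_mono:
  assumes "convex K" "cone K" "cone_le K b c"
  shows "primal_set A K b \<subseteq> primal_set A K c"
proof
  fix x assume x: "x \<in> primal_set A K b"
  then have "c - A *v x \<in> K"
    using convex_imp_cone_add_closed[OF assms(1,2), of "b - A *v x" "c - b"] assms(3)
    by (simp add: primal_set_def cone_le_def)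
  then show "x \<in> primal_set A K c"
    using x by (simp add: primal_set_def cone_le_def)
qed

lemma feas_fun_in_Gamma:
  assumes "convex K" "cone K" "pointed K"
  shows "feas_fun A K \<in> Gamma K"
proof -
  have "superadditive (feas_fun A K)"
    unfolding superadditive_def
  proof (intro allI)
    fix b c
    \<comment> \<open>With values 0 and -1, superadditivity could fail only if both summands are
      feasible and their sum is not.\<close>
    have "primal_set A K (b + c) \<noteq> {}" if "primal_set A K b \<noteq> {}" "primal_set A K c \<noteq> {}"
      using that primal_set_add[OF assms(1,2)] by blast
    then show "feas_fun A K b + feas_fun A K c \<le> feas_fun A K (b + c)"
      by (simp add: feas_fun_def)
  qed
  moreover have "nondecreasing_wrt K (feas_fun A K)"
    unfolding nondecreasing_wrt_def
  proof (intro allI impI)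
    fix b c assume "cone_le K b c"
    then have "primal_set A K b \<subseteq> primal_set A K c"
      by (rule primal_set_mono[OF assms(1,2)])
    then show "feas_fun A K b \<le> feas_fun A K c"
      by (auto simp: feas_fun_def)
  qed
  moreover have "feas_fun A K 0 = 0"
    using primal_set_zero[OF assms(3)] by (auto simp: feas_fun_def)
  ultimately show ?thesis
    by (simp add: Gamma_def)
qed

text \<open>Each column is feasible, so only the sign at \<open>b\<close> is left to decide, and the
  only negative value is -1.\<close>

lemma feas_fun_in_dual_set_iff:
  assumes "convex K" "cone K" "pointed K"
  shows "feas_fun A K \<in> dual_set A K b \<longleftrightarrow> feas_fun A K b = - 1"
proof -
  have "feas_fun A K (column j A) = 0" for j
    using primal_set_column[OF assms(3)] by (auto simp: feas_fun_def)
  then show ?thesis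
    using feas_fun_in_Gamma[OF assms] by (auto simp: dual_set_def feas_fun_def)
qed

lemma superadditive_sum_nonneg:
  assumes F: "superadditive F" "F 0 = 0" and "\<And>i. i \<in> I \<Longrightarrow> F (f i) \<ge> 0"
  shows "F (sum f I) \<ge> 0"
  using assms(3)
proof (induction I rule: infinite_finite_induct)
  case (insert i I)
  have "F (f i) + F (sum f I) \<le> F (f i + sum f I)"
    using F(1) by (simp add: superadditive_def)
  moreover have "F (f i) \<ge> 0" "F (sum f I) \<ge> 0"
    using insert.IH insert.prems by auto
  ultimately show ?case
    using insert.hyps by simp
\<comment> \<open>For empty or infinite \<open>I\<close> the sum is 0, which is where
  \<open>F 0 = 0\<close> enters.\<close>
qed (use F(2) in auto)

lemma superadditive_nat_scaleR_nonneg: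
  assumes "superadditive F" "F 0 = 0" "F a \<ge> 0" "r \<in> \<nat>"
  shows "F (r *\<^sub>R a) \<ge> 0"
proof -
  obtain k where "r = of_nat k"
    using assms(4) Nats_cases by blast
  \<comment> \<open>\<open>r *\<^sub>R a\<close> is a sum of \<open>k\<close> copies of
    \<open>a\<close>.\<close>
  then show ?thesis
    using superadditive_sum_nonneg[of F "{..<k}" "\<lambda>_. a"] assms
    by (simp add: sum_constant_scaleR)
qed

text \<open>Weak duality: a dual \<open>F\<close> would give 0 \<le> \<open>F (A *v x)\<close> \<le>
  \<open>F b\<close> < 0, since \<open>A *v x\<close> is a sum of columns with natural
  multiplicities.\<close>

lemma dual_set_empty_if_primal_nonempty:
  assumes "x \<in> primal_set A K b"
  shows "dual_set A K b = {}"
proof (rule ccontr)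
  assume "dual_set A K b \<noteq> {}"
  then obtain F where F: "superadditive F" "F 0 = 0" "nondecreasing_wrt K F"
    and neg: "F b < 0" and col: "\<And>j. F (column j A) \<ge> 0"
    by (auto simp: dual_set_def Gamma_def)
  have "F (\<Sum>j\<in>UNIV. x $ j *\<^sub>R column j A) \<ge> 0"
  proof (rule superadditive_sum_nonneg[OF F(1,2)])
    show "F (x $ j *\<^sub>R column j A) \<ge> 0" for j
      using assms superadditive_nat_scaleR_nonneg[OF F(1,2) col]
      by (simp add: primal_set_def)
  qed
  then have "F (A *v x) \<ge> 0"
    by (simp add: matrix_mult_sum scalar_mult_eq_scaleR)
  moreover have "F (A *v x) \<le> F b"
    using assms F(3) by (auto simp: primal_set_def nondecreasing_wrt_def)
  ultimately show False
    using neg by simp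
qed

theorem corollary1:
  fixes A :: "real^'n^'m" and K :: "(real^'m) set" and \<beta> :: "real^'m"
  assumes "closed K" and "convex K" and "cone K" and "pointed K"
  shows "(dual_set A K \<beta> \<noteq> {} \<longleftrightarrow> feas_fun A K \<in> dual_set A K \<beta>) \<and>
         (feas_fun A K \<in> dual_set A K \<beta> \<longleftrightarrow> feas_fun A K \<beta> = - 1)"
proof -
  \<comment> \<open>Weak duality in contrapositive form gives (i) to (iii); (ii) to (i) is
    immediate, as \<open>feas_fun A K\<close> is then a member.\<close>
  have "feas_fun A K \<beta> = - 1" if "dual_set A K \<beta> \<noteq> {}"
    using that dual_set_empty_if_primal_nonempty by (metis all_not_in_conv feas_fun_def)
  then show ?thesis
    using feas_fun_in_dual_set_iff[OF assms(2-4)] by blast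
qed

end
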